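(* Let $N\ge2$ and let $q\in\mathbb C$ be nonzero and not a root of unity. Let $T(u)$ and $\tilde T(u)$ denote the monodromy matrices of $\mathcal A_q$ and $\mathcal A_{q^{-1}}$ respectively (the standard Borel subalgebras of $U_q(\widehat{\mathfrak{gl}}_N)$ and $U_{q^{-1}}(\widehat{\mathfrak{gl}}_N)$, defined in the context by $RTT$ relations). (i) The map $\varphi$ defined by $\varphi\big(T(u)\big)=U\,\tilde T^{\,t}(u)\,U^{-1}$, where $U=\sum_{i=1}^N E_{i,N+1-i}$ (equivalently $\varphi(T_{i,j}(u))=\tilde T_{N+1-j,N+1-i}(u)$), defines an isomorphism of algebras from $\mathcal A_q$ to $\mathcal A_{q^{-1}}$. (ii) The map $\psi$ defined by $\psi\big(T(u)\big)=\tilde T^{\,t}(u^{-1})$ (equivalently $\psi(T_{i,j}(u))=\tilde T_{j,i}(u^{-1})$) defines an anti-isomorphism of algebras from $\mathcal A_q$ to $\mathcal A_{q^{-1}}$.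
   Context: $E_{ij}$ are the $N\times N$ matrix units, and $t$ is the matrix transposition $(E_{ij})^t=E_{ji}$ (acting only on the matrix part, so $(T^t)_{i,j}(u)=T_{j,i}(u)$). For a nonzero complex number $p$ that is not a root of unity put $$\mathsf f_p(u,v)=\frac{pu-p^{-1}v}{u-v},\quad \mathsf g_p(u,v)=\frac{p-p^{-1}}{u-v},\quad \mathsf g^{(l)}_p(u,v)=u\,\mathsf g_p(u,v),\quad \mathsf g^{(r)}_p(u,v)=v\,\mathsf g_p(u,v),$$ $$\mathrm R(u,v;p)=\mathsf f_p(u,v)\sum_{1\le i\le N}E_{ii}\otimes E_{ii}+\sum_{1\le i<j\le N}(E_{ii}\otimes E_{jj}+E_{jj}\otimes E_{ii})+\sum_{1\le i<j\le N}\big(\mathsf g_p^{(l)}(u,v)E_{ij}\otimes E_{ji}+\mathsf g_p^{(r)}(u,v)E_{ji}\otimes E_{ij}\big).$$ $\mathcal A_p$ is the unital associative $\mathbb C$-algebra generated by the entries $T_{i,j}(u)$, $1\le i,j\le N$, $u\in\mathbb C\setminus\{0\}$, of $T(u)=\sum_{i,j}E_{ij}\otimes T_{i,j}(u)$, subject to the relations, for all $u\ne v$, $$\mathrm R(u,v;p)\,(T(u)\otimes\mathbf 1)(\mathbf 1\otimes T(v))=(\mathbf 1\otimes T(v))(T(u)\otimes\mathbf 1)\,\mathrm R(u,v;p).$$ An anti-isomorphism is a bijective $\mathbb C$-linear unital map with $\psi(ab)=\psi(b)\psi(a)$. *)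

theory Defs
  imports
    Complex_Main
    "HOL-Library.Poly_Mapping"
    "HOL-Algebra.QuotRing"
    "HOL-Algebra.Module"
begin

section \<open>Unital associative algebras over the complex numbers, given by generators and relations\<close>

datatype 'a word = Word (letters: "'a list")

instantiation word :: (type) monoid_add
begin

definition zero_word :: "'a word"
  where "0 = Word []"

definition plus_word :: "'a word \<Rightarrow> 'a word \<Rightarrow> 'a word"
  where "v + w = Word (letters v @ letters w)"

instance
  by standard (simp_all add: zero_word_def plus_word_def)

end

text \<open>
  Words form the free monoid, written additively so that finitely supported functions on words
  carry the convolution product of \<^theory>\<open>HOL-Library.Poly_Mapping\<close>. They are the noncommutative
  polynomials, that is, the free algebra on the letters.
\<close>

type_synonym 'a nc_poly = "'a word \<Rightarrow>\<^sub>0 complex"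

definition scal :: "complex \<Rightarrow> 'a nc_poly"
  where "scal c = Poly_Mapping.single 0 c"

definition letter :: "'a \<Rightarrow> 'a nc_poly"
  where "letter x = Poly_Mapping.single (Word [x]) 1"

definition free_alg :: "'a set \<Rightarrow> (complex, 'a nc_poly) module"
  where "free_alg X =
    \<lparr>carrier = {f. \<forall>w \<in> Poly_Mapping.keys f. set (letters w) \<subseteq> X},
     mult = (*), one = 1, zero = 0, add = (+), smult = (\<lambda>c f. scal c * f)\<rparr>"

lemma ring_free_alg: "ring (free_alg X)"
proof (rule ringI)
  show "abelian_group (free_alg X)"
  proof (rule abelian_groupI)
    fix f assume f: "f \<in> carrier (free_alg X)"
    show "\<exists>g\<in>carrier (free_alg X). g \<oplus>\<^bsub>free_alg X\<^esub> f = \<zero>\<^bsub>free_alg X\<^esub>"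
      using f by (intro bexI[of _ "- f"]) (auto simp: free_alg_def)
  next
    fix f g assume "f \<in> carrier (free_alg X)" "g \<in> carrier (free_alg X)"
    then show "f \<oplus>\<^bsub>free_alg X\<^esub> g \<in> carrier (free_alg X)"
      using keys_add[of f g] by (auto simp: free_alg_def)
  qed (auto simp: free_alg_def algebra_simps)
  show "Group.monoid (free_alg X)"
  proof (rule monoidI)
    fix f g assume "f \<in> carrier (free_alg X)" "g \<in> carrier (free_alg X)"
    then show "f \<otimes>\<^bsub>free_alg X\<^esub> g \<in> carrier (free_alg X)"
      using keys_mult[of f g] by (fastforce simp: free_alg_def plus_word_def)
  qed (auto simp: free_alg_def algebra_simps zero_word_def)
qed (auto simp: free_alg_def algebra_simps)

text \<open>
  The ring quotient, with the induced scalar multiplication written in the same way as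
  \<^const>\<open>rcoset_mult\<close>. An ideal of a unital algebra is stable under scalars, so ring ideals and
  algebra ideals agree.
\<close>

definition quot_alg :: "(complex, 'a) module \<Rightarrow> 'a set \<Rightarrow> (complex, 'a set) module"
  where "quot_alg A I =
    ring.extend (A Quot I) (module.fields (\<lambda>c B. \<Union>b\<in>B. I +>\<^bsub>A\<^esub> (c \<odot>\<^bsub>A\<^esub> b)))"

text \<open>\<^const>\<open>genideal\<close> is the two-sided ideal generated by a set.\<close>

definition presented_alg :: "'a set \<Rightarrow> 'a nc_poly set \<Rightarrow> (complex, 'a nc_poly set) module"
  where "presented_alg X S = quot_alg (free_alg X) (genideal (free_alg X) S)"

definition alg_hom :: "(complex, 'a) module \<Rightarrow> (complex, 'b) module \<Rightarrow> ('a \<Rightarrow> 'b) set"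
  where "alg_hom A B = {h \<in> ring_hom A B.
    \<forall>c. \<forall>x \<in> carrier A. h (c \<odot>\<^bsub>A\<^esub> x) = c \<odot>\<^bsub>B\<^esub> h x}"

definition alg_anti_hom :: "(complex, 'a) module \<Rightarrow> (complex, 'b) module \<Rightarrow> ('a \<Rightarrow> 'b) set"
  where "alg_anti_hom A B = {h \<in> carrier A \<rightarrow> carrier B.
    (\<forall>x \<in> carrier A. \<forall>y \<in> carrier A. h (x \<oplus>\<^bsub>A\<^esub> y) = h x \<oplus>\<^bsub>B\<^esub> h y) \<and>
    (\<forall>c. \<forall>x \<in> carrier A. h (c \<odot>\<^bsub>A\<^esub> x) = c \<odot>\<^bsub>B\<^esub> h x) \<and>
    h \<one>\<^bsub>A\<^esub> = \<one>\<^bsub>B\<^esub> \<and>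
    (\<forall>x \<in> carrier A. \<forall>y \<in> carrier A. h (x \<otimes>\<^bsub>A\<^esub> y) = h y \<otimes>\<^bsub>B\<^esub> h x)}"

definition alg_iso :: "(complex, 'a) module \<Rightarrow> (complex, 'b) module \<Rightarrow> ('a \<Rightarrow> 'b) set"
  where "alg_iso A B = {h \<in> alg_hom A B. bij_betw h (carrier A) (carrier B)}"

definition alg_anti_iso :: "(complex, 'a) module \<Rightarrow> (complex, 'b) module \<Rightarrow> ('a \<Rightarrow> 'b) set"
  where "alg_anti_iso A B = {h \<in> alg_anti_hom A B. bij_betw h (carrier A) (carrier B)}"

section \<open>Matrices\<close>

text \<open>
  A matrix is a function of a row and a column index; only its entries at indices in the relevant
  finite set (\<open>{1..N}\<close>, or \<open>{1..N} \<times> {1..N}\<close> for a tensor square) are meaningful.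
\<close>

type_synonym ('i, 'a) matrix = "'i \<Rightarrow> 'i \<Rightarrow> 'a"

definition mat_eq :: "'i set \<Rightarrow> ('i, 'a) matrix \<Rightarrow> ('i, 'a) matrix \<Rightarrow> bool"
  where "mat_eq I A B \<longleftrightarrow> (\<forall>i\<in>I. \<forall>j\<in>I. A i j = B i j)"

definition mat_one :: "('i, 'a::zero_neq_one) matrix"
  where "mat_one i j = (if i = j then 1 else 0)"

definition mat_unit :: "'i \<Rightarrow> 'i \<Rightarrow> ('i, 'a::zero_neq_one) matrix"
  where "mat_unit i j = (\<lambda>a b. if a = i \<and> b = j then 1 else 0)"

definition mat_mul :: "'i set \<Rightarrow> ('i, 'a::semiring_0) matrix \<Rightarrow> ('i, 'a) matrix \<Rightarrow> ('i, 'a) matrix"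
  where "mat_mul I A B = (\<lambda>i j. \<Sum>k\<in>I. A i k * B k j)"

definition mat_transpose :: "('i, 'a) matrix \<Rightarrow> ('i, 'a) matrix"
  where "mat_transpose A = (\<lambda>i j. A j i)"

definition mat_inverse :: "'i set \<Rightarrow> ('i, complex) matrix \<Rightarrow> ('i, complex) matrix"
  where "mat_inverse I A =
    (SOME B. mat_eq I (mat_mul I A B) mat_one \<and> mat_eq I (mat_mul I B A) mat_one)"

definition tensor :: "('i, 'a::semiring_0) matrix \<Rightarrow> ('i, 'a) matrix \<Rightarrow> ('i \<times> 'i, 'a) matrix"
    (infixr \<open>\<otimes>\<^sub>m\<close> 75)
  where "A \<otimes>\<^sub>m B = (\<lambda>(i, k) (j, l). A i j * B k l)"

text \<open>Products of a complex matrix \<open>C\<close> and a matrix \<open>M\<close> over an algebra, in either order.\<close>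

definition cmat_mul_left ::
    "(complex, 'a) module \<Rightarrow> 'i set \<Rightarrow> ('i, complex) matrix \<Rightarrow> ('i, 'a) matrix \<Rightarrow> ('i, 'a) matrix"
  where "cmat_mul_left A I C M = (\<lambda>i j. \<Oplus>\<^bsub>A\<^esub>k\<in>I. C i k \<odot>\<^bsub>A\<^esub> M k j)"

definition cmat_mul_right ::
    "(complex, 'a) module \<Rightarrow> 'i set \<Rightarrow> ('i, 'a) matrix \<Rightarrow> ('i, complex) matrix \<Rightarrow> ('i, 'a) matrix"
  where "cmat_mul_right A I M C = (\<lambda>i j. \<Oplus>\<^bsub>A\<^esub>k\<in>I. C k j \<odot>\<^bsub>A\<^esub> M i k)"

section \<open>The R-matrix and the RTT algebra\<close>

definition f_fun :: "complex \<Rightarrow> complex \<Rightarrow> complex \<Rightarrow> complex"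
  where "f_fun p u v = (p * u - inverse p * v) / (u - v)"

definition g_fun :: "complex \<Rightarrow> complex \<Rightarrow> complex \<Rightarrow> complex"
  where "g_fun p u v = (p - inverse p) / (u - v)"

definition gl_fun :: "complex \<Rightarrow> complex \<Rightarrow> complex \<Rightarrow> complex"
  where "gl_fun p u v = u * g_fun p u v"

definition gr_fun :: "complex \<Rightarrow> complex \<Rightarrow> complex \<Rightarrow> complex"
  where "gr_fun p u v = v * g_fun p u v"

definition R_mat :: "nat \<Rightarrow> complex \<Rightarrow> complex \<Rightarrow> complex \<Rightarrow> (nat \<times> nat, complex) matrix"
  where "R_mat N u v p = (\<lambda>x y.
      f_fun p u v * (\<Sum>i\<in>{1..N}. (mat_unit i i \<otimes>\<^sub>m mat_unit i i) x y)
    + (\<Sum>(i, j)\<in>{(i, j). 1 \<le> i \<and> i < j \<and> j \<le> N}.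
        (mat_unit i i \<otimes>\<^sub>m mat_unit j j) x y + (mat_unit j j \<otimes>\<^sub>m mat_unit i i) x y)
    + (\<Sum>(i, j)\<in>{(i, j). 1 \<le> i \<and> i < j \<and> j \<le> N}.
        gl_fun p u v * (mat_unit i j \<otimes>\<^sub>m mat_unit j i) x y
      + gr_fun p u v * (mat_unit j i \<otimes>\<^sub>m mat_unit i j) x y))"

text \<open>The letter \<open>(i, j, u)\<close> stands for the generator $T_{i,j}(u)$.\<close>

type_synonym gen = "nat \<times> nat \<times> complex"

definition gens :: "nat \<Rightarrow> gen set"
  where "gens N = {1..N} \<times> {1..N} \<times> (UNIV - {0})"

definition T_free :: "complex \<Rightarrow> (nat, gen nc_poly) matrix"
  where "T_free u = (\<lambda>i j. letter (i, j, u))"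

definition RTT_lhs ::
    "nat \<Rightarrow> complex \<Rightarrow> complex \<Rightarrow> complex \<Rightarrow> (nat \<times> nat, gen nc_poly) matrix"
  where "RTT_lhs N p u v =
    (let I = {1..N} \<times> {1..N} in
      mat_mul I (\<lambda>x y. scal (R_mat N u v p x y))
        (mat_mul I (T_free u \<otimes>\<^sub>m mat_one) (mat_one \<otimes>\<^sub>m T_free v)))"

definition RTT_rhs ::
    "nat \<Rightarrow> complex \<Rightarrow> complex \<Rightarrow> complex \<Rightarrow> (nat \<times> nat, gen nc_poly) matrix"
  where "RTT_rhs N p u v =
    (let I = {1..N} \<times> {1..N} in
      mat_mul I (mat_mul I (mat_one \<otimes>\<^sub>m T_free v) (T_free u \<otimes>\<^sub>m mat_one))
        (\<lambda>x y. scal (R_mat N u v p x y)))"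

definition RTT_relations :: "nat \<Rightarrow> complex \<Rightarrow> gen nc_poly set"
  where "RTT_relations N p =
    {RTT_lhs N p u v x y - RTT_rhs N p u v x y | u v x y.
      u \<noteq> 0 \<and> v \<noteq> 0 \<and> u \<noteq> v \<and> x \<in> {1..N} \<times> {1..N} \<and> y \<in> {1..N} \<times> {1..N}}"

definition RTT_alg :: "nat \<Rightarrow> complex \<Rightarrow> (complex, gen nc_poly set) module"
  where "RTT_alg N p = presented_alg (gens N) (RTT_relations N p)"

definition T_mat :: "nat \<Rightarrow> complex \<Rightarrow> complex \<Rightarrow> (nat, gen nc_poly set) matrix"
  where "T_mat N p u =
    (\<lambda>i j. genideal (free_alg (gens N)) (RTT_relations N p) +>\<^bsub>free_alg (gens N)\<^esub> T_free u i j)"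

definition U_mat :: "nat \<Rightarrow> (nat, complex) matrix"
  where "U_mat N = (\<lambda>a b. \<Sum>i\<in>{1..N}. mat_unit i (N + 1 - i) a b)"

text \<open>The image of a matrix over an algebra under a map applied to each entry.\<close>

definition map_mat :: "('a \<Rightarrow> 'b) \<Rightarrow> ('i, 'a) matrix \<Rightarrow> ('i, 'b) matrix"
  where "map_mat h M = (\<lambda>i j. h (M i j))"

text \<open>$\varphi(T(u)) = U \tilde T^t(u) U^{-1}$ and $\psi(T(u)) = \tilde T^t(u^{-1})$\<close>

definition phi_rule :: "nat \<Rightarrow> complex \<Rightarrow> (gen nc_poly set \<Rightarrow> gen nc_poly set) \<Rightarrow> bool"
  where "phi_rule N q h \<longleftrightarrow> (\<forall>u. u \<noteq> 0 \<longrightarrow>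
    (let I = {1..N}; B = RTT_alg N (inverse q) in
      mat_eq I (map_mat h (T_mat N q u))
        (cmat_mul_right B I
          (cmat_mul_left B I (U_mat N) (mat_transpose (T_mat N (inverse q) u)))
          (mat_inverse I (U_mat N)))))"

definition psi_rule :: "nat \<Rightarrow> complex \<Rightarrow> (gen nc_poly set \<Rightarrow> gen nc_poly set) \<Rightarrow> bool"
  where "psi_rule N q h \<longleftrightarrow> (\<forall>u. u \<noteq> 0 \<longrightarrow>
    mat_eq {1..N} (map_mat h (T_mat N q u)) (mat_transpose (T_mat N (inverse q) (inverse u))))"

end

theory Submission
  imports Defs
begin

text \<open>
  Both maps permute the letters of the free algebra (and, for the anti-isomorphism, reverse words).
  The R-matrix satisfies
  \<open>R(v, u; 1/q)\<^bsub>y' x'\<^esub> = R(u, v; q)\<^bsub>x y\<^esub> = R(1/u, 1/v; 1/q)\<^bsub>y x\<^esub>\<close>,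
  where \<open>(i, j)' = (N + 1 - j, N + 1 - i)\<close>. Hence each of the two substitutions takes an entry of one
  side of the RTT relation for \<open>q\<close> to an entry of the opposite side of the relation for \<open>1/q\<close>, so that
  it negates relations and maps the defining ideals into each other. The substitutions are
  involutions on letters, which makes the induced maps bijective.
\<close>

section \<open>Substitution of words\<close>

definition push :: "('a word \<Rightarrow> 'b word) \<Rightarrow> 'a nc_poly \<Rightarrow> 'b nc_poly"
  where "push \<omega> f = (\<Sum>w\<in>Poly_Mapping.keys f. Poly_Mapping.single (\<omega> w) (Poly_Mapping.lookup f w))"

lemma push_superset:
  assumes "finite W" and "Poly_Mapping.keys f \<subseteq> W"
  shows "push \<omega> f = (\<Sum>w\<in>W. Poly_Mapping.single (\<omega> w) (Poly_Mapping.lookup f w))"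
  unfolding push_def using assms by (intro sum.mono_neutral_left) (auto simp: in_keys_iff)

lemma push_zero [simp]: "push \<omega> 0 = 0"
  by (simp add: push_def)

lemma push_single [simp]: "push \<omega> (Poly_Mapping.single w c) = Poly_Mapping.single (\<omega> w) c"
  by (simp add: push_def)

lemma push_add: "push \<omega> (f + g) = push \<omega> f + push \<omega> g"
proof -
  let ?W = "Poly_Mapping.keys f \<union> Poly_Mapping.keys g"
  have "finite ?W" and "Poly_Mapping.keys (f + g) \<subseteq> ?W"
    using keys_add[of f g] by auto
  then show ?thesis
    by (simp add: push_superset[of ?W] lookup_add single_add sum.distrib)
qed

lemma push_uminus: "push \<omega> (- f) = - push \<omega> f"
  using push_add[of \<omega> f "- f"] by (simp add: eq_neg_iff_add_eq_0 add.commute)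

lemma push_diff: "push \<omega> (f - g) = push \<omega> f - push \<omega> g"
  using push_add[of \<omega> f "- g"] by (simp add: push_uminus)

lemma push_sum: "push \<omega> (\<Sum>i\<in>J. F i) = (\<Sum>i\<in>J. push \<omega> (F i))"
  by (induction J rule: infinite_finite_induct) (simp_all add: push_add)

lemma sum_monomials:
  fixes f :: "'a \<Rightarrow>\<^sub>0 'b::comm_monoid_add"
  shows "(\<Sum>w\<in>Poly_Mapping.keys f. Poly_Mapping.single w (Poly_Mapping.lookup f w)) = f"
proof (rule poly_mapping_eqI)
  fix w
  show "Poly_Mapping.lookup (\<Sum>w\<in>Poly_Mapping.keys f.
      Poly_Mapping.single w (Poly_Mapping.lookup f w)) w = Poly_Mapping.lookup f w"
    by (simp add: lookup_sum lookup_single when_def in_keys_iff)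
qed

lemma mult_monomials:
  fixes f g :: "'a nc_poly"
  shows "f * g = (\<Sum>v\<in>Poly_Mapping.keys f. \<Sum>w\<in>Poly_Mapping.keys g.
    Poly_Mapping.single (v + w) (Poly_Mapping.lookup f v * Poly_Mapping.lookup g w))"
proof -
  have "f * g = (\<Sum>v\<in>Poly_Mapping.keys f. Poly_Mapping.single v (Poly_Mapping.lookup f v)) *
      (\<Sum>w\<in>Poly_Mapping.keys g. Poly_Mapping.single w (Poly_Mapping.lookup g w))"
    by (simp only: sum_monomials)
  then show ?thesis
    by (simp add: sum_product mult_single)
qed

lemma push_mult:
  assumes "\<And>v w. \<omega> (v + w) = \<omega> v + \<omega> w"
  shows "push \<omega> (f * g) = push \<omega> f * push \<omega> g"
  by (simp add: mult_monomials[of f g] push_sum assms)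
    (simp add: push_def sum_product mult_single)

lemma push_anti_mult:
  assumes "\<And>v w. \<omega> (v + w) = \<omega> w + \<omega> v"
  shows "push \<omega> (f * g) = push \<omega> g * push \<omega> f"
  by (simp add: mult_monomials[of f g] push_sum assms)
    (simp add: push_def sum_product mult_single mult.commute sum.swap[of _ "Poly_Mapping.keys g"])

lemma push_scal_mult:
  assumes "\<And>v w. \<omega> (v + w) = \<omega> v + \<omega> w \<or> \<omega> (v + w) = \<omega> w + \<omega> v" and "\<omega> 0 = 0"
  shows "push \<omega> (scal c * f) = scal c * push \<omega> f"
proof -
  have "scal c * f = (\<Sum>w\<in>Poly_Mapping.keys f. Poly_Mapping.single w (c * Poly_Mapping.lookup f w))"
    by (subst sum_monomials[of f, symmetric])
      (simp add: scal_def sum_distrib_left mult_single)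
  then show ?thesis
    by (simp add: push_sum) (simp add: push_def scal_def sum_distrib_left mult_single)
qed

lemma push_push: "push \<omega> (push \<omega>' f) = push (\<omega> \<circ> \<omega>') f"
  by (simp add: push_def[of \<omega>'] push_def[of "\<omega> \<circ> \<omega>'"] push_sum)

lemma push_idem:
  assumes "\<And>w. w \<in> Poly_Mapping.keys f \<Longrightarrow> \<omega> w = w"
  shows "push \<omega> f = f"
  using sum_monomials[of f] by (simp add: push_def assms)

lemma keys_push: "Poly_Mapping.keys (push \<omega> f) \<subseteq> \<omega> ` Poly_Mapping.keys f"
  unfolding push_def by (rule order_trans[OF keys_sum]) auto

section \<open>Free algebras and their quotients\<close>

lemma free_alg_simps [simp]:
  "f \<oplus>\<^bsub>free_alg X\<^esub> g = f + g" "f \<otimes>\<^bsub>free_alg X\<^esub> g = f * g"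
  "\<zero>\<^bsub>free_alg X\<^esub> = 0" "\<one>\<^bsub>free_alg X\<^esub> = 1" "c \<odot>\<^bsub>free_alg X\<^esub> f = scal c * f"
  by (simp_all add: free_alg_def)

lemma mem_free_alg:
  "f \<in> carrier (free_alg X) \<longleftrightarrow> (\<forall>w\<in>Poly_Mapping.keys f. set (letters w) \<subseteq> X)"
  by (simp add: free_alg_def)

lemma free_alg_closed [simp]:
  "0 \<in> carrier (free_alg X)" "1 \<in> carrier (free_alg X)" "scal c \<in> carrier (free_alg X)"
  "x \<in> X \<Longrightarrow> letter x \<in> carrier (free_alg X)"
  by (auto simp: mem_free_alg scal_def letter_def zero_word_def split: if_splits)

lemma free_alg_uminus_closed [simp]: "f \<in> carrier (free_alg X) \<Longrightarrow> - f \<in> carrier (free_alg X)"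
  by (simp add: mem_free_alg in_keys_iff)

lemma free_alg_ops_closed [simp]:
  assumes "f \<in> carrier (free_alg X)" "g \<in> carrier (free_alg X)"
  shows "f + g \<in> carrier (free_alg X)" "f * g \<in> carrier (free_alg X)"
    "f - g \<in> carrier (free_alg X)"
proof -
  interpret ring "free_alg X" by (rule ring_free_alg)
  show "f + g \<in> carrier (free_alg X)" using a_closed[OF assms] by simp
  show "f * g \<in> carrier (free_alg X)" using m_closed[OF assms] by simp
  show "f - g \<in> carrier (free_alg X)"
    using assms keys_diff[of f g] by (auto simp: mem_free_alg)
qed

lemma free_alg_sum_closed:
  "(\<And>i. i \<in> J \<Longrightarrow> F i \<in> carrier (free_alg X)) \<Longrightarrow> (\<Sum>i\<in>J. F i) \<in> carrier (free_alg X)"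
  by (induction J rule: infinite_finite_induct) auto

lemma free_alg_induct [consumes 1, case_names one letter add mult smult]:
  assumes "f \<in> carrier (free_alg X)"
    and one: "P 1"
    and letter: "\<And>x. x \<in> X \<Longrightarrow> P (letter x)"
    and add: "\<And>f g. f \<in> carrier (free_alg X) \<Longrightarrow> g \<in> carrier (free_alg X) \<Longrightarrow> P f \<Longrightarrow> P g \<Longrightarrow> P (f + g)"
    and mult: "\<And>f g. f \<in> carrier (free_alg X) \<Longrightarrow> g \<in> carrier (free_alg X) \<Longrightarrow> P f \<Longrightarrow> P g \<Longrightarrow> P (f * g)"
    and smult: "\<And>c f. f \<in> carrier (free_alg X) \<Longrightarrow> P f \<Longrightarrow> P (scal c * f)"
  shows "P f"
proof -
  have word: "Poly_Mapping.single (Word xs) 1 \<in> carrier (free_alg X) \<and> P (Poly_Mapping.single (Word xs) 1)"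
    if "set xs \<subseteq> X" for xs
    using that
  proof (induction xs)
    case Nil
    have "Poly_Mapping.single (Word []) 1 = (1 :: 'a nc_poly)"
      by (simp flip: zero_word_def)
    then show ?case using one by simp
  next
    case (Cons x xs)
    have "Poly_Mapping.single (Word (x # xs)) 1 = letter x * Poly_Mapping.single (Word xs) 1"
      by (simp add: letter_def mult_single plus_word_def)
    then show ?case using Cons letter mult by simp
  qed
  have mono: "Poly_Mapping.single w c \<in> carrier (free_alg X) \<and> P (Poly_Mapping.single w c)"
    if "set (letters w) \<subseteq> X" for w c
  proof -
    have "Poly_Mapping.single w c = scal c * Poly_Mapping.single w 1"
      by (simp add: scal_def mult_single)
    then show ?thesis using word[OF that] smult by simp
  qed
  have zero: "P 0" using smult[OF _ one, of 0] by (simp add: scal_def)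
  have "(\<Sum>w\<in>W. Poly_Mapping.single w (Poly_Mapping.lookup f w)) \<in> carrier (free_alg X) \<and>
      P (\<Sum>w\<in>W. Poly_Mapping.single w (Poly_Mapping.lookup f w))"
    if "finite W" "W \<subseteq> Poly_Mapping.keys f" for W
    using that
  proof (induction W)
    case empty
    then show ?case using zero by simp
  next
    case (insert w W)
    then have "set (letters w) \<subseteq> X" using assms(1) by (auto simp: mem_free_alg)
    then show ?case using insert mono[of w "Poly_Mapping.lookup f w"] add by simp
  qed
  from this[OF finite_keys order_refl] show ?thesis by (simp add: sum_monomials)
qed

lemma coset_free_alg: "I +>\<^bsub>free_alg X\<^esub> f = (\<lambda>a. a + f) ` I"
  by (auto simp: a_r_coset_def')

lemma quot_free_alg:
  assumes "ideal I (free_alg X)"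
  shows carrier_quot_alg: "carrier (quot_alg (free_alg X) I) = (\<lambda>f. I +>\<^bsub>free_alg X\<^esub> f) ` carrier (free_alg X)"
    and one_quot_alg: "\<one>\<^bsub>quot_alg (free_alg X) I\<^esub> = I +>\<^bsub>free_alg X\<^esub> 1"
    and zero_quot_alg: "\<zero>\<^bsub>quot_alg (free_alg X) I\<^esub> = I +>\<^bsub>free_alg X\<^esub> 0"
    and add_quot_alg: "\<And>f g. f \<in> carrier (free_alg X) \<Longrightarrow> g \<in> carrier (free_alg X) \<Longrightarrow>
      (I +>\<^bsub>free_alg X\<^esub> f) \<oplus>\<^bsub>quot_alg (free_alg X) I\<^esub> (I +>\<^bsub>free_alg X\<^esub> g) = I +>\<^bsub>free_alg X\<^esub> (f + g)"
    and mult_quot_alg: "\<And>f g. f \<in> carrier (free_alg X) \<Longrightarrow> g \<in> carrier (free_alg X) \<Longrightarrow>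
      (I +>\<^bsub>free_alg X\<^esub> f) \<otimes>\<^bsub>quot_alg (free_alg X) I\<^esub> (I +>\<^bsub>free_alg X\<^esub> g) = I +>\<^bsub>free_alg X\<^esub> (f * g)"
    and smult_quot_alg: "\<And>c f. f \<in> carrier (free_alg X) \<Longrightarrow>
      c \<odot>\<^bsub>quot_alg (free_alg X) I\<^esub> (I +>\<^bsub>free_alg X\<^esub> f) = I +>\<^bsub>free_alg X\<^esub> (scal c * f)"
proof -
  interpret ideal I "free_alg X" by fact
  note defs = quot_alg_def ring.defs module.defs FactRing_def
  show "carrier (quot_alg (free_alg X) I) = (\<lambda>f. I +>\<^bsub>free_alg X\<^esub> f) ` carrier (free_alg X)"
    by (auto simp: defs A_RCOSETS_def')
  show "\<one>\<^bsub>quot_alg (free_alg X) I\<^esub> = I +>\<^bsub>free_alg X\<^esub> 1"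
    by (simp add: defs)
  show "\<zero>\<^bsub>quot_alg (free_alg X) I\<^esub> = I +>\<^bsub>free_alg X\<^esub> 0"
    by (simp add: defs coset_free_alg)
  show "(I +>\<^bsub>free_alg X\<^esub> f) \<oplus>\<^bsub>quot_alg (free_alg X) I\<^esub> (I +>\<^bsub>free_alg X\<^esub> g) = I +>\<^bsub>free_alg X\<^esub> (f + g)"
    if "f \<in> carrier (free_alg X)" "g \<in> carrier (free_alg X)" for f g
    using a_rcos_sum[OF that] by (simp add: defs)
  show "(I +>\<^bsub>free_alg X\<^esub> f) \<otimes>\<^bsub>quot_alg (free_alg X) I\<^esub> (I +>\<^bsub>free_alg X\<^esub> g) = I +>\<^bsub>free_alg X\<^esub> (f * g)"
    if "f \<in> carrier (free_alg X)" "g \<in> carrier (free_alg X)" for f g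
    using rcoset_mult_add[OF that] by (simp add: defs)
  show "c \<odot>\<^bsub>quot_alg (free_alg X) I\<^esub> (I +>\<^bsub>free_alg X\<^esub> f) = I +>\<^bsub>free_alg X\<^esub> (scal c * f)"
    if f: "f \<in> carrier (free_alg X)" for c f
  proof -
    have "I +>\<^bsub>free_alg X\<^esub> (scal c * (a + f)) = I +>\<^bsub>free_alg X\<^esub> (scal c * f)" if "a \<in> I" for a
    proof -
      have "scal c * a \<in> I" using I_l_closed[OF that, of "scal c"] by simp
      then have "scal c * (a + f) \<in> I +>\<^bsub>free_alg X\<^esub> (scal c * f)"
        by (auto simp: coset_free_alg distrib_left)
      then show ?thesis
        using a_repr_independence'[of _ "scal c * f"] f by simp
    qed
    moreover have "0 \<in> I" using additive_subgroup.zero_closed[OF is_additive_subgroup] by simp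
    ultimately show ?thesis
      by (auto simp: defs coset_free_alg[of X I f])
  qed
qed

lemma abelian_monoid_quot_alg:
  assumes "ideal I (free_alg X)"
  shows "abelian_monoid (quot_alg (free_alg X) I)"
  by (rule abelian_monoidI)
    (auto simp: quot_free_alg[OF assms] add_ac)

locale word_involution =
  fixes X :: "'a set" and \<omega> :: "'a word \<Rightarrow> 'a word"
  assumes add_or_anti: "(\<forall>v w. \<omega> (v + w) = \<omega> v + \<omega> w) \<or> (\<forall>v w. \<omega> (v + w) = \<omega> w + \<omega> v)"
    and zero: "\<omega> 0 = 0"
    and letters: "set (letters w) \<subseteq> X \<Longrightarrow> set (letters (\<omega> w)) \<subseteq> X"
    and involution: "set (letters w) \<subseteq> X \<Longrightarrow> \<omega> (\<omega> w) = w"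
begin

lemma push_closed: "f \<in> carrier (free_alg X) \<Longrightarrow> push \<omega> f \<in> carrier (free_alg X)"
  using keys_push[of \<omega> f] letters by (fastforce simp: mem_free_alg)

lemma push_inv: "f \<in> carrier (free_alg X) \<Longrightarrow> push \<omega> (push \<omega> f) = f"
  by (simp add: push_push push_idem mem_free_alg involution)

lemma push_one: "push \<omega> 1 = 1"
  using zero by (simp flip: single_one)

lemma push_scal: "push \<omega> (scal c * f) = scal c * push \<omega> f"
  using add_or_anti zero by (intro push_scal_mult) auto

lemma ideal_push_vimage:
  assumes "ideal I (free_alg X)"
  shows "ideal {f \<in> carrier (free_alg X). push \<omega> f \<in> I} (free_alg X)" (is "ideal ?J _")
proof (rule idealI[OF ring_free_alg])
  interpret ideal I "free_alg X" by fact
  have add: "f + g \<in> I" if "f \<in> I" "g \<in> I" for f g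
    using additive_subgroup.a_closed[OF is_additive_subgroup that] by simp
  have mult: "f * g \<in> I" "g * f \<in> I" if "f \<in> I" "g \<in> carrier (free_alg X)" for f g
    using I_l_closed[OF that] I_r_closed[OF that] by auto
  show "subgroup ?J (add_monoid (free_alg X))"
  proof (rule add.subgroupI)
    have "0 \<in> I" using additive_subgroup.zero_closed[OF is_additive_subgroup] by simp
    then have "0 \<in> ?J" by simp
    then show "?J \<noteq> {}" by blast
  next
    fix f assume f: "f \<in> ?J"
    have "\<ominus>\<^bsub>free_alg X\<^esub> f = - f"
      using f by (intro minus_equality) auto
    moreover have "- push \<omega> f \<in> I"
      using f mult(2)[OF _ free_alg_closed(3), of "push \<omega> f" "- 1"]
      by (simp add: scal_def single_uminus)
    ultimately show "\<ominus>\<^bsub>free_alg X\<^esub> f \<in> ?J"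
      using f by (simp add: push_uminus)
  qed (auto simp: push_add add)
  show "g \<otimes>\<^bsub>free_alg X\<^esub> f \<in> ?J" if "f \<in> ?J" "g \<in> carrier (free_alg X)" for f g
    using that add_or_anti mult push_closed[OF that(2)]
    by (auto simp: push_mult push_anti_mult)
  show "f \<otimes>\<^bsub>free_alg X\<^esub> g \<in> ?J" if "f \<in> ?J" "g \<in> carrier (free_alg X)" for f g
    using that add_or_anti mult push_closed[OF that(2)]
    by (auto simp: push_mult push_anti_mult)
qed

lemma push_genideal:
  assumes "S \<subseteq> carrier (free_alg X)" and "S' \<subseteq> carrier (free_alg X)"
    and "push \<omega> ` S \<subseteq> genideal (free_alg X) S'"
  shows "push \<omega> ` genideal (free_alg X) S \<subseteq> genideal (free_alg X) S'"
proof -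
  interpret ring "free_alg X" by (rule ring_free_alg)
  have "genideal (free_alg X) S \<subseteq>
      {f \<in> carrier (free_alg X). push \<omega> f \<in> genideal (free_alg X) S'}"
    using assms by (intro genideal_minimal ideal_push_vimage genideal_ideal) auto
  then show ?thesis by blast
qed

end

text \<open>
  Since \<^term>\<open>push \<omega>\<close> exchanges the two ideals, it takes cosets to cosets, and the induced map of the
  quotients is simply the image \<^term>\<open>(`) (push \<omega>)\<close>.
\<close>

locale presented_exchange = word_involution X \<omega>
  for X :: "'a set" and \<omega> :: "'a word \<Rightarrow> 'a word" +
  fixes S S' :: "'a nc_poly set"
  assumes relations: "S \<subseteq> carrier (free_alg X)" "S' \<subseteq> carrier (free_alg X)"
    and push_relations: "push \<omega> ` S \<subseteq> genideal (free_alg X) S'" "push \<omega> ` S' \<subseteq> genideal (free_alg X) S"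
begin

abbreviation "I \<equiv> genideal (free_alg X) S"
abbreviation "I' \<equiv> genideal (free_alg X) S'"

lemma ideals: "ideal I (free_alg X)" "ideal I' (free_alg X)"
  using ring.genideal_ideal[OF ring_free_alg] relations by auto

lemma push_ideal: "push \<omega> ` I = I'" "push \<omega> ` I' = I"
proof -
  have sub: "push \<omega> ` I \<subseteq> I'" "push \<omega> ` I' \<subseteq> I"
    using push_genideal relations push_relations by blast+
  have inv: "push \<omega> (push \<omega> f) = f" if "f \<in> I \<union> I'" for f
    using that ideals[THEN ideal.axioms(1)] additive_subgroup.a_subset push_inv by blast
  show "push \<omega> ` I = I'" "push \<omega> ` I' = I"
    using sub inv by (force simp: image_subset_iff image_iff)+
qed

lemma push_coset:
  "push \<omega> ` (I +>\<^bsub>free_alg X\<^esub> f) = I' +>\<^bsub>free_alg X\<^esub> push \<omega> f"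
  "push \<omega> ` (I' +>\<^bsub>free_alg X\<^esub> f) = I +>\<^bsub>free_alg X\<^esub> push \<omega> f"
proof -
  have "push \<omega> ` (J +>\<^bsub>free_alg X\<^esub> f) = (push \<omega> ` J) +>\<^bsub>free_alg X\<^esub> push \<omega> f" for J
    by (simp add: coset_free_alg image_image push_add)
  then show "push \<omega> ` (I +>\<^bsub>free_alg X\<^esub> f) = I' +>\<^bsub>free_alg X\<^esub> push \<omega> f"
    and "push \<omega> ` (I' +>\<^bsub>free_alg X\<^esub> f) = I +>\<^bsub>free_alg X\<^esub> push \<omega> f"
    by (simp_all only: push_ideal)
qed

lemma bij_betw_push:
  "bij_betw ((`) (push \<omega>)) (carrier (presented_alg X S)) (carrier (presented_alg X S'))"
  by (rule bij_betw_byWitness[where f' = "(`) (push \<omega>)"])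
    (auto simp: presented_alg_def carrier_quot_alg ideals push_coset push_inv push_closed)

lemma carrier_presented:
  "carrier (presented_alg X S) = (\<lambda>f. I +>\<^bsub>free_alg X\<^esub> f) ` carrier (free_alg X)"
  by (simp add: presented_alg_def carrier_quot_alg ideals)

lemma push_linear:
  "(`) (push \<omega>) \<in> carrier (presented_alg X S) \<rightarrow> carrier (presented_alg X S')"
  "\<lbrakk>x \<in> carrier (presented_alg X S); y \<in> carrier (presented_alg X S)\<rbrakk> \<Longrightarrow>
    push \<omega> ` (x \<oplus>\<^bsub>presented_alg X S\<^esub> y) = push \<omega> ` x \<oplus>\<^bsub>presented_alg X S'\<^esub> push \<omega> ` y"
  "x \<in> carrier (presented_alg X S) \<Longrightarrow>
    push \<omega> ` (c \<odot>\<^bsub>presented_alg X S\<^esub> x) = c \<odot>\<^bsub>presented_alg X S'\<^esub> push \<omega> ` x"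
  "push \<omega> ` \<one>\<^bsub>presented_alg X S\<^esub> = \<one>\<^bsub>presented_alg X S'\<^esub>"
  unfolding carrier_presented
  by (elim imageE | simp add: presented_alg_def quot_free_alg ideals push_coset push_closed
      push_add push_scal push_one Pi_iff)+

lemma push_alg_iso:
  assumes "\<And>v w. \<omega> (v + w) = \<omega> v + \<omega> w"
  shows "(`) (push \<omega>) \<in> alg_iso (presented_alg X S) (presented_alg X S')"
proof -
  have "push \<omega> ` (x \<otimes>\<^bsub>presented_alg X S\<^esub> y) = push \<omega> ` x \<otimes>\<^bsub>presented_alg X S'\<^esub> push \<omega> ` y"
    if "x \<in> carrier (presented_alg X S)" "y \<in> carrier (presented_alg X S)" for x y
    using that unfolding carrier_presented
    by (elim imageE) (simp add: presented_alg_def mult_quot_alg ideals push_coset push_closed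
        push_mult[OF assms])
  then have "(`) (push \<omega>) \<in> ring_hom (presented_alg X S) (presented_alg X S')"
    using push_linear by (intro ring_hom_memI) (simp_all add: Pi_iff)
  then show ?thesis
    using bij_betw_push push_linear(3) by (simp add: alg_iso_def alg_hom_def)
qed

lemma push_alg_anti_iso:
  assumes "\<And>v w. \<omega> (v + w) = \<omega> w + \<omega> v"
  shows "(`) (push \<omega>) \<in> alg_anti_iso (presented_alg X S) (presented_alg X S')"
proof -
  have "push \<omega> ` (x \<otimes>\<^bsub>presented_alg X S\<^esub> y) = push \<omega> ` y \<otimes>\<^bsub>presented_alg X S'\<^esub> push \<omega> ` x"
    if "x \<in> carrier (presented_alg X S)" "y \<in> carrier (presented_alg X S)" for x y
    using that unfolding carrier_presented
    by (elim imageE) (simp add: presented_alg_def mult_quot_alg ideals push_coset push_closed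
        push_anti_mult[OF assms])
  then show ?thesis
    using bij_betw_push push_linear by (simp add: alg_anti_iso_def alg_anti_hom_def)
qed

end

lemma presented_alg_induct [consumes 2, case_names one letter add mult smult]:
  assumes "S \<subseteq> carrier (free_alg X)" and "x \<in> carrier (presented_alg X S)"
    and one: "P \<one>\<^bsub>presented_alg X S\<^esub>"
    and letter: "\<And>a. a \<in> X \<Longrightarrow> P (genideal (free_alg X) S +>\<^bsub>free_alg X\<^esub> letter a)"
    and add: "\<And>x y. x \<in> carrier (presented_alg X S) \<Longrightarrow> y \<in> carrier (presented_alg X S) \<Longrightarrow>
      P x \<Longrightarrow> P y \<Longrightarrow> P (x \<oplus>\<^bsub>presented_alg X S\<^esub> y)"
    and mult: "\<And>x y. x \<in> carrier (presented_alg X S) \<Longrightarrow> y \<in> carrier (presented_alg X S) \<Longrightarrow>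
      P x \<Longrightarrow> P y \<Longrightarrow> P (x \<otimes>\<^bsub>presented_alg X S\<^esub> y)"
    and smult: "\<And>c x. x \<in> carrier (presented_alg X S) \<Longrightarrow> P x \<Longrightarrow> P (c \<odot>\<^bsub>presented_alg X S\<^esub> x)"
  shows "P x"
proof -
  let ?I = "genideal (free_alg X) S"
  have I: "ideal ?I (free_alg X)"
    using ring.genideal_ideal[OF ring_free_alg assms(1)] .
  note simps = quot_free_alg[OF I, folded presented_alg_def]
  obtain f where f: "f \<in> carrier (free_alg X)" and x: "x = ?I +>\<^bsub>free_alg X\<^esub> f"
    using assms(2) by (auto simp: simps)
  have mem: "?I +>\<^bsub>free_alg X\<^esub> g \<in> carrier (presented_alg X S)" if "g \<in> carrier (free_alg X)" for g
    using that by (auto simp: simps)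
  from f have "P (?I +>\<^bsub>free_alg X\<^esub> f)"
  proof (induction rule: free_alg_induct)
    case one
    then show ?case using assms(3) by (simp add: simps)
  next
    case (letter a)
    then show ?case by (rule assms(4))
  next
    case (add f g)
    then show ?case using assms(5)[OF mem mem, of f g] by (simp add: simps)
  next
    case (mult f g)
    then show ?case using assms(6)[OF mem mem, of f g] by (simp add: simps)
  next
    case (smult c f)
    then show ?case using assms(7)[OF mem, of f c] by (simp add: simps)
  qed
  then show ?thesis by (simp add: x)
qed

lemma alg_hom_eqI:
  assumes "S \<subseteq> carrier (free_alg X)" and "x \<in> carrier (presented_alg X S)"
    and h: "h \<in> alg_hom (presented_alg X S) B" and k: "k \<in> alg_hom (presented_alg X S) B"
    and "\<And>a. a \<in> X \<Longrightarrow> h (genideal (free_alg X) S +>\<^bsub>free_alg X\<^esub> letter a) =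
      k (genideal (free_alg X) S +>\<^bsub>free_alg X\<^esub> letter a)"
  shows "h x = k x"
  using assms(1,2)
  by (induction rule: presented_alg_induct)
    (use h k assms(5) in \<open>simp_all add: alg_hom_def ring_hom_def\<close>)

lemma alg_anti_hom_eqI:
  assumes "S \<subseteq> carrier (free_alg X)" and "x \<in> carrier (presented_alg X S)"
    and h: "h \<in> alg_anti_hom (presented_alg X S) B" and k: "k \<in> alg_anti_hom (presented_alg X S) B"
    and "\<And>a. a \<in> X \<Longrightarrow> h (genideal (free_alg X) S +>\<^bsub>free_alg X\<^esub> letter a) =
      k (genideal (free_alg X) S +>\<^bsub>free_alg X\<^esub> letter a)"
  shows "h x = k x"
  using assms(1,2)
  by (induction rule: presented_alg_induct)
    (use h k assms(5) in \<open>simp_all add: alg_anti_hom_def\<close>)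

section \<open>RTT relations\<close>

lemma R_mat_entry:
  assumes "a \<in> {1..N}" "b \<in> {1..N}"
  shows "R_mat N u v p (a, b) (c, d) =
    (if a = c \<and> b = d then (if a = b then f_fun p u v else 1) else 0) +
    (if a = d \<and> b = c \<and> a < b then gl_fun p u v else 0) +
    (if a = d \<and> b = c \<and> b < a then gr_fun p u v else 0)"
proof -
  let ?P = "{(i, j). 1 \<le> i \<and> i < j \<and> j \<le> N}"
  let ?E = "\<lambda>i j k l. (mat_unit i j \<otimes>\<^sub>m mat_unit k l) (a, b) (c, d) :: complex"
  have fin: "finite ?P"
    by (rule finite_subset[of _ "{1..N} \<times> {1..N}"]) auto
  have delta: "(\<Sum>z\<in>?P. if z = w then r else 0) = (if w \<in> ?P then r else 0)" for w and r :: complex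
    using fin by (rule sum.delta)
  have E: "?E i j k l = (if a = i \<and> b = k then if c = j \<and> d = l then 1 else 0 else 0)" for i j k l
    by (simp add: tensor_def mat_unit_def)
  have diag: "(\<Sum>i\<in>{1..N}. ?E i i i i) = (if a = c \<and> b = d \<and> a = b then 1 else 0)"
  proof -
    have "?E i i i i = (if i = a then (if a = c \<and> b = d \<and> a = b then 1 else 0) else 0)" for i
      unfolding E by auto
    then show ?thesis using assms by simp
  qed
  have units: "?E i i j j = (if (i, j) = (a, b) then if a = c \<and> b = d then 1 else 0 else 0)"
    "?E j j i i = (if (i, j) = (b, a) then if a = c \<and> b = d then 1 else 0 else 0)"
    "?E i j j i = (if (i, j) = (a, b) then if a = d \<and> b = c then 1 else 0 else 0)"
    "?E j i i j = (if (i, j) = (b, a) then if a = d \<and> b = c then 1 else 0 else 0)" for i j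
    unfolding E by auto
  have "(\<Sum>(i, j)\<in>?P. ?E i i j j + ?E j j i i) =
      (\<Sum>z\<in>?P. (if z = (a, b) then if a = c \<and> b = d then 1 else 0 else 0) +
        (if z = (b, a) then if a = c \<and> b = d then 1 else 0 else 0))"
    unfolding units case_prod_beta prod.collapse
    by (rule sum.cong[OF refl], rule arg_cong2[where f = "(+)"]) auto
  then have perm: "(\<Sum>(i, j)\<in>?P. ?E i i j j + ?E j j i i) = (if a = c \<and> b = d \<and> a \<noteq> b then 1 else 0)"
    using assms unfolding sum.distrib delta
    by (cases a b rule: linorder_cases) simp_all
  have "(\<Sum>(i, j)\<in>?P. r * ?E i j j i + s * ?E j i i j) =
      (\<Sum>z\<in>?P. (if z = (a, b) then if a = d \<and> b = c then r else 0 else 0) +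
        (if z = (b, a) then if a = d \<and> b = c then s else 0 else 0))" for r s :: complex
    unfolding units case_prod_beta prod.collapse
    by (rule sum.cong[OF refl], rule arg_cong2[where f = "(+)"]) auto
  then have swap: "(\<Sum>(i, j)\<in>?P. r * ?E i j j i + s * ?E j i i j) =
      (if a = d \<and> b = c \<and> a < b then r else 0) + (if a = d \<and> b = c \<and> b < a then s else 0)" for r s
    using assms unfolding sum.distrib delta
    by (cases a b rule: linorder_cases) simp_all
  show ?thesis
    unfolding R_mat_def diag perm swap by (cases a b rule: linorder_cases) simp_all
qed

lemma RTT_lhs_entry:
  assumes "c \<in> {1..N}" "d \<in> {1..N}"
  shows "RTT_lhs N p u v x (c, d) =
    (\<Sum>(e, f)\<in>{1..N} \<times> {1..N}. scal (R_mat N u v p x (e, f)) * (letter (e, c, u) * letter (f, d, v)))"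
proof -
  have "mat_mul ({1..N} \<times> {1..N}) (T_free u \<otimes>\<^sub>m mat_one) (mat_one \<otimes>\<^sub>m T_free v) (e, f) (c, d) =
      letter (e, c, u) * letter (f, d, v)" if "f \<in> {1..N}" for e f
  proof -
    have "mat_mul ({1..N} \<times> {1..N}) (T_free u \<otimes>\<^sub>m mat_one) (mat_one \<otimes>\<^sub>m T_free v) (e, f) (c, d) =
      (\<Sum>z\<in>{1..N} \<times> {1..N}. if z = (c, f) then letter (e, c, u) * letter (f, d, v) else 0)"
      unfolding mat_mul_def
      by (rule sum.cong) (auto simp: tensor_def mat_one_def T_free_def split: if_splits)
    then show ?thesis using assms that by (simp add: sum.delta)
  qed
  moreover have "RTT_lhs N p u v x (c, d) = (\<Sum>z\<in>{1..N} \<times> {1..N}. scal (R_mat N u v p x z) *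
      mat_mul ({1..N} \<times> {1..N}) (T_free u \<otimes>\<^sub>m mat_one) (mat_one \<otimes>\<^sub>m T_free v) z (c, d))"
    by (simp only: RTT_lhs_def Let_def mat_mul_def)
  ultimately show ?thesis
    by (auto intro: sum.cong)
qed

lemma RTT_rhs_entry:
  assumes "a \<in> {1..N}" "b \<in> {1..N}"
  shows "RTT_rhs N p u v (a, b) y =
    (\<Sum>(e, f)\<in>{1..N} \<times> {1..N}. letter (b, f, v) * letter (a, e, u) * scal (R_mat N u v p (e, f) y))"
proof -
  have "mat_mul ({1..N} \<times> {1..N}) (mat_one \<otimes>\<^sub>m T_free v) (T_free u \<otimes>\<^sub>m mat_one) (a, b) (e, f) =
      letter (b, f, v) * letter (a, e, u)" if "f \<in> {1..N}" for e f
  proof -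
    have "mat_mul ({1..N} \<times> {1..N}) (mat_one \<otimes>\<^sub>m T_free v) (T_free u \<otimes>\<^sub>m mat_one) (a, b) (e, f) =
      (\<Sum>z\<in>{1..N} \<times> {1..N}. if z = (a, f) then letter (b, f, v) * letter (a, e, u) else 0)"
      unfolding mat_mul_def
      by (rule sum.cong) (auto simp: tensor_def mat_one_def T_free_def split: if_splits)
    then show ?thesis using assms that by (simp add: sum.delta)
  qed
  moreover have "RTT_rhs N p u v (a, b) y = (\<Sum>z\<in>{1..N} \<times> {1..N}.
      mat_mul ({1..N} \<times> {1..N}) (mat_one \<otimes>\<^sub>m T_free v) (T_free u \<otimes>\<^sub>m mat_one) (a, b) z *
      scal (R_mat N u v p z y))"
    by (simp only: RTT_rhs_def Let_def mat_mul_def)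
  ultimately show ?thesis
    by (auto intro: sum.cong)
qed

lemma RTT_relations_closed: "RTT_relations N p \<subseteq> carrier (free_alg (gens N))"
proof
  fix r assume "r \<in> RTT_relations N p"
  then obtain u v x y where r: "r = RTT_lhs N p u v x y - RTT_rhs N p u v x y"
    and uv: "u \<noteq> 0" "v \<noteq> 0" and xy: "x \<in> {1..N} \<times> {1..N}" "y \<in> {1..N} \<times> {1..N}"
    unfolding RTT_relations_def by blast
  obtain a b c d where "x = (a, b)" "y = (c, d)" by force
  with xy have mem: "x = (a, b)" "y = (c, d)" "a \<in> {1..N}" "b \<in> {1..N}" "c \<in> {1..N}" "d \<in> {1..N}"
    by auto
  have letter: "letter (i, j, w) \<in> carrier (free_alg (gens N))"
    if "i \<in> {1..N}" "j \<in> {1..N}" "w \<noteq> 0" for i j w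
    by (rule free_alg_closed) (use that in \<open>simp add: gens_def\<close>)
  have "RTT_lhs N p u v x y \<in> carrier (free_alg (gens N))"
    unfolding mem(1,2) RTT_lhs_entry[OF mem(5,6)]
    by (rule free_alg_sum_closed, clarify, intro free_alg_ops_closed(2) free_alg_closed(3) letter)
      (use mem uv in auto)
  moreover have "RTT_rhs N p u v x y \<in> carrier (free_alg (gens N))"
    unfolding mem(1,2) RTT_rhs_entry[OF mem(3,4)]
    by (rule free_alg_sum_closed, clarify, intro free_alg_ops_closed(2) free_alg_closed(3) letter)
      (use mem uv in auto)
  ultimately show "r \<in> carrier (free_alg (gens N))"
    unfolding r by (rule free_alg_ops_closed)
qed

lemma scal_commute: "f * scal c = scal c * f"
proof -
  have "(\<Sum>w\<in>W. Poly_Mapping.single w (F w)) * scal c = scal c * (\<Sum>w\<in>W. Poly_Mapping.single w (F w))"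
    for W :: "'a word set" and F
    by (simp add: scal_def sum_distrib_left sum_distrib_right mult_single mult.commute)
  from this[where W = "Poly_Mapping.keys f" and F = "Poly_Mapping.lookup f"] show ?thesis
    by (simp only: sum_monomials)
qed

lemma f_fun_inverse:
  shows "f_fun (inverse q) v u = f_fun q u v"
    and "u \<noteq> 0 \<Longrightarrow> v \<noteq> 0 \<Longrightarrow> f_fun q (inverse v) (inverse u) = f_fun q u v"
proof -
  show "f_fun (inverse q) v u = f_fun q u v"
    using minus_divide_divide[of "q * u - inverse q * v" "u - v"] by (simp add: f_fun_def)
  show "f_fun q (inverse v) (inverse u) = f_fun q u v" if "u \<noteq> 0" "v \<noteq> 0"
  proof -
    have "q * inverse v - inverse q * inverse u = (q * u - inverse q * v) / (u * v)"
      and "inverse v - inverse u = (u - v) / (u * v)"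
      using that by (simp_all add: field_simps)
    then show ?thesis using that by (simp add: f_fun_def)
  qed
qed

lemma g_fun_inverse:
  shows "gl_fun (inverse q) v u = gr_fun q u v" and "gr_fun (inverse q) v u = gl_fun q u v"
    and "u \<noteq> 0 \<Longrightarrow> v \<noteq> 0 \<Longrightarrow> gl_fun q (inverse v) (inverse u) = gl_fun q u v"
    and "u \<noteq> 0 \<Longrightarrow> v \<noteq> 0 \<Longrightarrow> gr_fun q (inverse v) (inverse u) = gr_fun q u v"
proof -
  have "g_fun (inverse q) v u = g_fun q u v"
    using minus_divide_divide[of "q - inverse q" "u - v"] by (simp add: g_fun_def)
  then show "gl_fun (inverse q) v u = gr_fun q u v" "gr_fun (inverse q) v u = gl_fun q u v"
    by (simp_all add: gl_fun_def gr_fun_def)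
  show "gl_fun q (inverse v) (inverse u) = gl_fun q u v"
    "gr_fun q (inverse v) (inverse u) = gr_fun q u v" if "u \<noteq> 0" "v \<noteq> 0"
  proof -
    have "inverse v - inverse u = (u - v) / (u * v)"
      using that by (simp add: field_simps)
    then show "gl_fun q (inverse v) (inverse u) = gl_fun q u v"
      "gr_fun q (inverse v) (inverse u) = gr_fun q u v"
      using that by (simp_all add: gl_fun_def gr_fun_def g_fun_def)
  qed
qed

fun flip_letter :: "nat \<Rightarrow> gen \<Rightarrow> gen"
  where "flip_letter N (i, j, u) = (N + 1 - j, N + 1 - i, u)"

fun inv_letter :: "gen \<Rightarrow> gen"
  where "inv_letter (i, j, u) = (j, i, inverse u)"

definition rev_word :: "('a \<Rightarrow> 'b) \<Rightarrow> 'a word \<Rightarrow> 'b word"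
  where "rev_word \<sigma> w = Word (rev (map \<sigma> (letters w)))"

lemma map_word_add: "map_word \<sigma> (v + w) = map_word \<sigma> v + map_word \<sigma> w"
  by (simp add: plus_word_def word.map_sel)

lemma rev_word_add: "rev_word \<sigma> (v + w) = rev_word \<sigma> w + rev_word \<sigma> v"
  by (simp add: plus_word_def rev_word_def)

lemma word_involution_map_word:
  assumes "\<And>x. x \<in> X \<Longrightarrow> \<sigma> x \<in> X \<and> \<sigma> (\<sigma> x) = x"
  shows "word_involution X (map_word \<sigma>)"
proof
  show "map_word \<sigma> (map_word \<sigma> w) = w" if "set (letters w) \<subseteq> X" for w
    using that assms by (cases w) (auto intro!: map_idI)
qed (use assms in \<open>auto simp: map_word_add zero_word_def word.map_sel\<close>)

lemma word_involution_rev_word: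
  assumes "\<And>x. x \<in> X \<Longrightarrow> \<sigma> x \<in> X \<and> \<sigma> (\<sigma> x) = x"
  shows "word_involution X (rev_word \<sigma>)"
proof
  show "rev_word \<sigma> (rev_word \<sigma> w) = w" if "set (letters w) \<subseteq> X" for w
    using that assms by (cases w) (auto simp: rev_word_def rev_map intro!: map_idI)
  show "(\<forall>v w. rev_word \<sigma> (v + w) = rev_word \<sigma> v + rev_word \<sigma> w) \<or>
      (\<forall>v w. rev_word \<sigma> (v + w) = rev_word \<sigma> w + rev_word \<sigma> v)"
    by (simp add: rev_word_add)
qed (use assms in \<open>auto simp: rev_word_def zero_word_def\<close>)

lemma push_letter [simp]:
  "push (map_word \<sigma>) (letter x) = letter (\<sigma> x)"
  "push (rev_word \<sigma>) (letter x) = letter (\<sigma> x)"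
  by (simp_all add: letter_def rev_word_def)

abbreviation (input) flip_pair :: "nat \<Rightarrow> nat \<times> nat \<Rightarrow> nat \<times> nat"
  where "flip_pair N \<equiv> \<lambda>(i, j). (N + 1 - j, N + 1 - i)"

lemma R_mat_flip:
  assumes "x \<in> {1..N} \<times> {1..N}" "y \<in> {1..N} \<times> {1..N}"
  shows "R_mat N v u (inverse q) (flip_pair N y) (flip_pair N x) = R_mat N u v q x y"
proof -
  obtain a b c d where xy: "x = (a, b)" "y = (c, d)" by force
  with assms have mem: "a \<in> {1..N}" "b \<in> {1..N}" "c \<in> {1..N}" "d \<in> {1..N}" by auto
  then have flipped: "N + 1 - c \<in> {1..N}" "N + 1 - d \<in> {1..N}" by auto
  have flip_eq: "N + 1 - i = N + 1 - j \<longleftrightarrow> i = j" and flip_less: "N + 1 - i < N + 1 - j \<longleftrightarrow> j < i"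
    if "i \<in> {1..N}" "j \<in> {1..N}" for i j
    using that by auto
  show ?thesis
    unfolding xy prod.case R_mat_entry[OF mem(1,2)] R_mat_entry[OF flipped(2,1)]
    by (simp only: flip_eq flip_less mem f_fun_inverse g_fun_inverse) auto
qed

lemma R_mat_inverse:
  assumes "x \<in> {1..N} \<times> {1..N}" "y \<in> {1..N} \<times> {1..N}" "u \<noteq> 0" "v \<noteq> 0"
  shows "R_mat N (inverse u) (inverse v) (inverse q) y x = R_mat N u v q x y"
  using assms by (auto simp: R_mat_entry f_fun_inverse g_fun_inverse)

lemma push_flip:
  assumes "x \<in> {1..N} \<times> {1..N}" "y \<in> {1..N} \<times> {1..N}"
  shows push_flip_lhs: "push (map_word (flip_letter N)) (RTT_lhs N q u v x y) =
      RTT_rhs N (inverse q) v u (flip_pair N y) (flip_pair N x)"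
    and push_flip_rhs: "push (map_word (flip_letter N)) (RTT_rhs N q u v x y) =
      RTT_lhs N (inverse q) v u (flip_pair N y) (flip_pair N x)"
proof -
  obtain a b c d where xy: "x = (a, b)" "y = (c, d)" by force
  with assms have mem: "a \<in> {1..N}" "b \<in> {1..N}" "c \<in> {1..N}" "d \<in> {1..N}" by auto
  then have flipped: "N + 1 - a \<in> {1..N}" "N + 1 - b \<in> {1..N}" "N + 1 - c \<in> {1..N}" "N + 1 - d \<in> {1..N}"
    by auto
  have push: "push (map_word \<sigma>) (scal r * f) = scal r * push (map_word \<sigma>) f"
    "push (map_word \<sigma>) (f * g) = push (map_word \<sigma>) f * push (map_word \<sigma>) g" for r \<sigma> and f g :: "gen nc_poly"
    by (rule push_scal_mult, auto simp: map_word_add zero_word_def push_mult)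
  show "push (map_word (flip_letter N)) (RTT_lhs N q u v x y) =
      RTT_rhs N (inverse q) v u (flip_pair N y) (flip_pair N x)"
    unfolding xy prod.case RTT_lhs_entry[OF mem(3,4)] RTT_rhs_entry[OF flipped(4,3)] push_sum
    by (rule sum.reindex_bij_witness[of _ "flip_pair N" "flip_pair N"])
      (use R_mat_flip[OF assms(1), of _ v u q] xy in
        \<open>auto simp: push(1) push(2)[of _ "letter _"] scal_commute\<close>)
  show "push (map_word (flip_letter N)) (RTT_rhs N q u v x y) =
      RTT_lhs N (inverse q) v u (flip_pair N y) (flip_pair N x)"
    unfolding xy prod.case RTT_rhs_entry[OF mem(1,2)] RTT_lhs_entry[OF flipped(2,1)] push_sum
    by (rule sum.reindex_bij_witness[of _ "flip_pair N" "flip_pair N"])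
      (use R_mat_flip[OF _ assms(2), of _ v u q] xy in
        \<open>auto simp: push(1) push(2)[of _ "letter _"] scal_commute\<close>)
qed

lemma push_rev:
  assumes "x \<in> {1..N} \<times> {1..N}" "y \<in> {1..N} \<times> {1..N}" "u \<noteq> 0" "v \<noteq> 0"
  shows push_rev_lhs: "push (rev_word inv_letter) (RTT_lhs N q u v x y) =
      RTT_rhs N (inverse q) (inverse u) (inverse v) y x"
    and push_rev_rhs: "push (rev_word inv_letter) (RTT_rhs N q u v x y) =
      RTT_lhs N (inverse q) (inverse u) (inverse v) y x"
proof -
  obtain a b c d where xy: "x = (a, b)" "y = (c, d)" by force
  with assms have mem: "a \<in> {1..N}" "b \<in> {1..N}" "c \<in> {1..N}" "d \<in> {1..N}" by auto
  have push: "push (rev_word \<sigma>) (scal r * f) = scal r * push (rev_word \<sigma>) f"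
    "push (rev_word \<sigma>) (f * g) = push (rev_word \<sigma>) g * push (rev_word \<sigma>) f" for r \<sigma> and f g :: "gen nc_poly"
    by (rule push_scal_mult, simp add: rev_word_add, simp add: zero_word_def rev_word_def)
      (simp add: push_anti_mult rev_word_add)
  show "push (rev_word inv_letter) (RTT_lhs N q u v x y) =
      RTT_rhs N (inverse q) (inverse u) (inverse v) y x"
    unfolding xy RTT_lhs_entry[OF mem(3,4)] RTT_rhs_entry[OF mem(3,4)] push_sum
    by (rule sum.cong) (use R_mat_inverse[OF assms(1) _ assms(3,4), of _ q] xy in
        \<open>auto simp: push(1) push(2)[of _ "letter _"] scal_commute\<close>)
  show "push (rev_word inv_letter) (RTT_rhs N q u v x y) =
      RTT_lhs N (inverse q) (inverse u) (inverse v) y x"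
    unfolding xy RTT_lhs_entry[OF mem(1,2)] RTT_rhs_entry[OF mem(1,2)] push_sum
    by (rule sum.cong) (use R_mat_inverse[OF _ assms(2) assms(3,4), of _ q] xy in
        \<open>auto simp: push(1) push(2)[of _ "letter _"] scal_commute\<close>)
qed

section \<open>The two maps\<close>

lemma flip_letter_involution: "x \<in> gens N \<Longrightarrow> flip_letter N x \<in> gens N \<and> flip_letter N (flip_letter N x) = x"
  by (auto simp: gens_def)

lemma inv_letter_involution: "x \<in> gens N \<Longrightarrow> inv_letter x \<in> gens N \<and> inv_letter (inv_letter x) = x"
  by (auto simp: gens_def)

lemma minus_mem_genideal:
  assumes "S \<subseteq> carrier (free_alg X)" "f - g \<in> S"
  shows "g - f \<in> genideal (free_alg X) S"
proof -
  interpret ideal "genideal (free_alg X) S" "free_alg X"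
    using ring.genideal_ideal[OF ring_free_alg assms(1)] .
  have "scal (- 1) * (f - g) \<in> genideal (free_alg X) S"
    using I_l_closed[of "f - g" "scal (- 1)"] genideal_self[OF assms(1)] assms(2) by auto
  then show ?thesis by (simp add: scal_def single_uminus)
qed

lemma RTT_relation_mem:
  assumes "u \<noteq> 0" "v \<noteq> 0" "u \<noteq> v" "x \<in> {1..N} \<times> {1..N}" "y \<in> {1..N} \<times> {1..N}"
  shows "RTT_rhs N p u v x y - RTT_lhs N p u v x y \<in> genideal (free_alg (gens N)) (RTT_relations N p)"
  by (rule minus_mem_genideal[OF RTT_relations_closed])
    (use assms in \<open>unfold RTT_relations_def, blast\<close>)

lemma push_flip_relations:
  "push (map_word (flip_letter N)) ` RTT_relations N q \<subseteq>
    genideal (free_alg (gens N)) (RTT_relations N (inverse q))"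
proof (rule image_subsetI)
  fix r assume "r \<in> RTT_relations N q"
  then obtain u v x y where r: "r = RTT_lhs N q u v x y - RTT_rhs N q u v x y"
    and uv: "u \<noteq> 0" "v \<noteq> 0" "u \<noteq> v" and xy: "x \<in> {1..N} \<times> {1..N}" "y \<in> {1..N} \<times> {1..N}"
    unfolding RTT_relations_def by blast
  have "flip_pair N y \<in> {1..N} \<times> {1..N}" "flip_pair N x \<in> {1..N} \<times> {1..N}"
    using xy by auto
  then show "push (map_word (flip_letter N)) r \<in> genideal (free_alg (gens N)) (RTT_relations N (inverse q))"
    using uv unfolding r push_diff push_flip[OF xy] by (intro RTT_relation_mem) auto
qed

lemma push_rev_relations:
  "push (rev_word inv_letter) ` RTT_relations N q \<subseteq>
    genideal (free_alg (gens N)) (RTT_relations N (inverse q))"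
proof (rule image_subsetI)
  fix r assume "r \<in> RTT_relations N q"
  then obtain u v x y where r: "r = RTT_lhs N q u v x y - RTT_rhs N q u v x y"
    and uv: "u \<noteq> 0" "v \<noteq> 0" "u \<noteq> v" and xy: "x \<in> {1..N} \<times> {1..N}" "y \<in> {1..N} \<times> {1..N}"
    unfolding RTT_relations_def by blast
  show "push (rev_word inv_letter) r \<in> genideal (free_alg (gens N)) (RTT_relations N (inverse q))"
    using uv xy unfolding r push_diff push_rev[OF xy uv(1,2)] by (intro RTT_relation_mem) auto
qed

lemma presented_exchange_flip:
  "presented_exchange (gens N) (map_word (flip_letter N)) (RTT_relations N q) (RTT_relations N (inverse q))"
  using word_involution_map_word[of "gens N" "flip_letter N", OF flip_letter_involution] RTT_relations_closed
    push_flip_relations[of N q] push_flip_relations[of N "inverse q"]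
  by (auto simp: presented_exchange_def presented_exchange_axioms_def)

lemma presented_exchange_rev:
  "presented_exchange (gens N) (rev_word inv_letter) (RTT_relations N q) (RTT_relations N (inverse q))"
  using word_involution_rev_word[of "gens N" inv_letter, OF inv_letter_involution] RTT_relations_closed
    push_rev_relations[of N q] push_rev_relations[of N "inverse q"]
  by (auto simp: presented_exchange_def presented_exchange_axioms_def)

lemma U_mat_entry: "U_mat N a b = (if a \<in> {1..N} \<and> b = N + 1 - a then 1 else 0)"
proof -
  have "U_mat N a b = (\<Sum>i\<in>{1..N}. if i = a then (if b = N + 1 - a then 1 else 0) else 0)"
    unfolding U_mat_def by (rule sum.cong) (auto simp: mat_unit_def)
  then show ?thesis by simp
qed

lemma U_mat_mul:
  assumes "a \<in> {1..N}"
  shows "mat_mul {1..N} (U_mat N) B a b = B (N + 1 - a) b"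
proof -
  have "N + 1 - a \<in> {1..N}" using assms by auto
  moreover have "mat_mul {1..N} (U_mat N) B a b =
      (\<Sum>k\<in>{1..N}. if k = N + 1 - a then B (N + 1 - a) b else 0)"
    unfolding mat_mul_def U_mat_entry using assms by (intro sum.cong[OF refl]) simp
  ultimately show ?thesis by (simp only: sum.delta finite_atLeastAtMost if_True)
qed

lemma mat_inverse_U_mat: "mat_eq {1..N} (mat_inverse {1..N} (U_mat N)) (U_mat N)"
proof -
  let ?inv = "\<lambda>B. mat_eq {1..N} (mat_mul {1..N} (U_mat N) B) mat_one \<and>
    mat_eq {1..N} (mat_mul {1..N} B (U_mat N)) mat_one"
  have flip: "N + 1 - a \<in> {1..N}" "N + 1 - (N + 1 - a) = a" if "a \<in> {1..N}" for a
    using that by auto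
  have "mat_mul {1..N} (U_mat N) (U_mat N) a b = mat_one a b" if "a \<in> {1..N}" "b \<in> {1..N}" for a b
    unfolding U_mat_mul[OF that(1)] U_mat_entry mat_one_def flip(2)[OF that(1)]
    using flip(1)[OF that(1)] by (simp only: simp_thms) (rule if_cong, rule eq_commute, rule refl, rule refl)
  then have "?inv (U_mat N)"
    unfolding mat_eq_def by blast
  then have inv: "?inv (mat_inverse {1..N} (U_mat N))"
    unfolding mat_inverse_def by (rule someI[of ?inv])
  have "mat_inverse {1..N} (U_mat N) a b = U_mat N a b" if "a \<in> {1..N}" "b \<in> {1..N}" for a b
  proof -
    have "mat_inverse {1..N} (U_mat N) a b = mat_mul {1..N} (U_mat N) (mat_inverse {1..N} (U_mat N)) (N + 1 - a) b"
      by (simp only: U_mat_mul[OF flip(1)[OF that(1)]] flip(2)[OF that(1)])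
    also have "\<dots> = mat_one (N + 1 - a) b"
      using inv flip(1)[OF that(1)] that(2) unfolding mat_eq_def by blast
    finally show ?thesis
      unfolding U_mat_entry mat_one_def
      using that(1) by (simp only: simp_thms) (rule if_cong, rule eq_commute, rule refl, rule refl)
  qed
  then show ?thesis by (simp add: mat_eq_def)
qed

lemma RTT_ideal: "ideal (genideal (free_alg (gens N)) (RTT_relations N p)) (free_alg (gens N))"
  using ring.genideal_ideal[OF ring_free_alg RTT_relations_closed] .

lemma T_mat_closed:
  assumes "i \<in> {1..N}" "j \<in> {1..N}" "u \<noteq> 0"
  shows "T_mat N p u i j \<in> carrier (RTT_alg N p)"
proof -
  have "(i, j, u) \<in> gens N" using assms by (simp add: gens_def)
  then show ?thesis
    by (auto simp: RTT_alg_def presented_alg_def carrier_quot_alg[OF RTT_ideal] T_mat_def T_free_def)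
qed

lemma RTT_smult:
  assumes "x \<in> carrier (RTT_alg N p)"
  shows "1 \<odot>\<^bsub>RTT_alg N p\<^esub> x = x" and "0 \<odot>\<^bsub>RTT_alg N p\<^esub> x = \<zero>\<^bsub>RTT_alg N p\<^esub>"
  using assms
  by (auto simp: RTT_alg_def presented_alg_def quot_free_alg[OF RTT_ideal]) (simp_all add: scal_def)

lemma finsum_RTT_delta:
  assumes "finite K" "m \<in> K" "\<And>k. k \<in> K \<Longrightarrow> x k \<in> carrier (RTT_alg N p)"
    and "\<And>k. k \<in> K \<Longrightarrow> c k = (if k = m then 1 else 0)"
  shows "(\<Oplus>\<^bsub>RTT_alg N p\<^esub>k\<in>K. c k \<odot>\<^bsub>RTT_alg N p\<^esub> x k) = x m"
proof -
  interpret abelian_monoid "RTT_alg N p"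
    using abelian_monoid_quot_alg[OF RTT_ideal] by (simp add: RTT_alg_def presented_alg_def)
  have "(\<Oplus>\<^bsub>RTT_alg N p\<^esub>k\<in>K. c k \<odot>\<^bsub>RTT_alg N p\<^esub> x k) =
      (\<Oplus>\<^bsub>RTT_alg N p\<^esub>k\<in>K. if m = k then x k else \<zero>\<^bsub>RTT_alg N p\<^esub>)"
    using assms(3) by (intro finsum_cong') (auto simp: assms(4) RTT_smult)
  also have "\<dots> = x m"
    using assms by (intro finsum_singleton) auto
  finally show ?thesis .
qed

lemma phi_rule_iff:
  "phi_rule N q h \<longleftrightarrow> (\<forall>i\<in>{1..N}. \<forall>j\<in>{1..N}. \<forall>u. u \<noteq> 0 \<longrightarrow>
    h (T_mat N q u i j) = T_mat N (inverse q) u (N + 1 - j) (N + 1 - i))"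
proof -
  have "cmat_mul_right (RTT_alg N p) {1..N}
      (cmat_mul_left (RTT_alg N p) {1..N} (U_mat N) (mat_transpose (T_mat N p u)))
      (mat_inverse {1..N} (U_mat N)) i j = T_mat N p u (N + 1 - j) (N + 1 - i)"
    if "u \<noteq> 0" and ij: "i \<in> {1..N}" "j \<in> {1..N}" for p u i j
  proof -
    have left: "cmat_mul_left (RTT_alg N p) {1..N} (U_mat N) (mat_transpose (T_mat N p u)) i k =
        T_mat N p u k (N + 1 - i)" if "k \<in> {1..N}" for k
      unfolding cmat_mul_left_def mat_transpose_def
      by (rule finsum_RTT_delta) (use \<open>u \<noteq> 0\<close> ij that in \<open>auto simp: T_mat_closed U_mat_entry\<close>)
    have right: "mat_inverse {1..N} (U_mat N) k j = (if k = N + 1 - j then 1 else 0)"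
      if "k \<in> {1..N}" for k
      using mat_inverse_U_mat that ij by (auto simp: mat_eq_def U_mat_entry)
    have flipped: "N + 1 - j \<in> {1..N}" "N + 1 - i \<in> {1..N}" using ij by auto
    show ?thesis
      unfolding cmat_mul_right_def left[OF flipped(1), symmetric]
      by (rule finsum_RTT_delta)
        (use flipped right left T_mat_closed \<open>u \<noteq> 0\<close> in \<open>simp_all del: One_nat_def\<close>)
  qed
  then show ?thesis
    unfolding phi_rule_def Let_def mat_eq_def map_mat_def by (auto simp del: One_nat_def)
qed

lemma psi_rule_iff:
  "psi_rule N q h \<longleftrightarrow> (\<forall>i\<in>{1..N}. \<forall>j\<in>{1..N}. \<forall>u. u \<noteq> 0 \<longrightarrow>
    h (T_mat N q u i j) = T_mat N (inverse q) (inverse u) j i)"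
  unfolding psi_rule_def mat_eq_def map_mat_def mat_transpose_def by blast

theorem proposition4p1:
  fixes N :: nat and q :: complex
  assumes "N \<ge> 2" and "q \<noteq> 0" and "\<forall>n>0. q ^ n \<noteq> 1"
  shows
    "(\<exists>\<phi> \<in> alg_iso (RTT_alg N q) (RTT_alg N (inverse q)).
        phi_rule N q \<phi> \<and>
        (\<forall>i\<in>{1..N}. \<forall>j\<in>{1..N}. \<forall>u. u \<noteq> 0 \<longrightarrow>
          \<phi> (T_mat N q u i j) = T_mat N (inverse q) u (N + 1 - j) (N + 1 - i)) \<and>
        (\<forall>h \<in> alg_hom (RTT_alg N q) (RTT_alg N (inverse q)).
          phi_rule N q h \<longrightarrow> (\<forall>x \<in> carrier (RTT_alg N q). h x = \<phi> x)))
     \<and>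
     (\<exists>\<psi> \<in> alg_anti_iso (RTT_alg N q) (RTT_alg N (inverse q)).
        psi_rule N q \<psi> \<and>
        (\<forall>i\<in>{1..N}. \<forall>j\<in>{1..N}. \<forall>u. u \<noteq> 0 \<longrightarrow>
          \<psi> (T_mat N q u i j) = T_mat N (inverse q) (inverse u) j i) \<and>
        (\<forall>h \<in> alg_anti_hom (RTT_alg N q) (RTT_alg N (inverse q)).
          psi_rule N q h \<longrightarrow> (\<forall>x \<in> carrier (RTT_alg N q). h x = \<psi> x)))"
proof (intro conjI)
  interpret flip: presented_exchange "gens N" "map_word (flip_letter N)"
      "RTT_relations N q" "RTT_relations N (inverse q)"
    by (rule presented_exchange_flip)
  interpret rev: presented_exchange "gens N" "rev_word inv_letter"
      "RTT_relations N q" "RTT_relations N (inverse q)"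
    by (rule presented_exchange_rev)
  define \<phi> where "\<phi> = (`) (push (map_word (flip_letter N)))"
  define \<psi> where "\<psi> = (`) (push (rev_word inv_letter))"
  have \<phi>_iso: "\<phi> \<in> alg_iso (RTT_alg N q) (RTT_alg N (inverse q))"
    unfolding \<phi>_def RTT_alg_def by (rule flip.push_alg_iso) (rule map_word_add)
  have \<phi>_T: "\<phi> (T_mat N q u i j) = T_mat N (inverse q) u (N + 1 - j) (N + 1 - i)" for u i j
    unfolding \<phi>_def T_mat_def T_free_def flip.push_coset(1) by simp
  have \<psi>_iso: "\<psi> \<in> alg_anti_iso (RTT_alg N q) (RTT_alg N (inverse q))"
    unfolding \<psi>_def RTT_alg_def by (rule rev.push_alg_anti_iso) (rule rev_word_add)
  have \<psi>_T: "\<psi> (T_mat N q u i j) = T_mat N (inverse q) (inverse u) j i" for u i j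
    unfolding \<psi>_def T_mat_def T_free_def rev.push_coset(1) by simp
  note generator = T_mat_def T_free_def gens_def
  have \<phi>_unique: "h x = \<phi> x"
    if "h \<in> alg_hom (RTT_alg N q) (RTT_alg N (inverse q))" "phi_rule N q h"
      "x \<in> carrier (RTT_alg N q)" for h x
    using alg_hom_eqI[OF RTT_relations_closed, of x N q h _ \<phi>] that \<phi>_iso \<phi>_T
    by (auto simp: phi_rule_iff alg_iso_def RTT_alg_def generator)
  have \<psi>_unique: "h x = \<psi> x"
    if "h \<in> alg_anti_hom (RTT_alg N q) (RTT_alg N (inverse q))" "psi_rule N q h"
      "x \<in> carrier (RTT_alg N q)" for h x
    using alg_anti_hom_eqI[OF RTT_relations_closed, of x N q h _ \<psi>] that \<psi>_iso \<psi>_T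
    by (auto simp: psi_rule_iff alg_anti_iso_def RTT_alg_def generator)
  show "\<exists>\<phi> \<in> alg_iso (RTT_alg N q) (RTT_alg N (inverse q)).
      phi_rule N q \<phi> \<and>
      (\<forall>i\<in>{1..N}. \<forall>j\<in>{1..N}. \<forall>u. u \<noteq> 0 \<longrightarrow>
        \<phi> (T_mat N q u i j) = T_mat N (inverse q) u (N + 1 - j) (N + 1 - i)) \<and>
      (\<forall>h \<in> alg_hom (RTT_alg N q) (RTT_alg N (inverse q)).
        phi_rule N q h \<longrightarrow> (\<forall>x \<in> carrier (RTT_alg N q). h x = \<phi> x))"
    using \<phi>_iso \<phi>_T \<phi>_unique by (intro bexI[of _ \<phi>]) (auto simp: phi_rule_iff)
  show "\<exists>\<psi> \<in> alg_anti_iso (RTT_alg N q) (RTT_alg N (inverse q)).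
      psi_rule N q \<psi> \<and>
      (\<forall>i\<in>{1..N}. \<forall>j\<in>{1..N}. \<forall>u. u \<noteq> 0 \<longrightarrow>
        \<psi> (T_mat N q u i j) = T_mat N (inverse q) (inverse u) j i) \<and>
      (\<forall>h \<in> alg_anti_hom (RTT_alg N q) (RTT_alg N (inverse q)).
        psi_rule N q h \<longrightarrow> (\<forall>x \<in> carrier (RTT_alg N q). h x = \<psi> x))"
    using \<psi>_iso \<psi>_T \<psi>_unique by (intro bexI[of _ \<psi>]) (auto simp: psi_rule_iff)
qed

end
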